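(* Let $H_0\colon D(H_0)\subseteq\mathcal{H}\to\mathcal{H}$ be a densely defined, closed operator on a Hilbert space $\mathcal{H}$ and let $(\Omega,\mathcal{G}_1,\mathcal{G}_2,F,\omega)$ be a boundary system for $H_0$, where $\Omega$ is the standard symmetric form on $\mathcal{H}\oplus\mathcal{H}$ and $\omega$ is the standard unitary form on $\mathcal{G}_1\oplus\mathcal{G}_2$. Let $L_0\colon\mathcal{G}_1\to\mathcal{G}_2$ be a unitary operator and let $\Gamma_1,\Gamma_2\colon D(-H_0^{\star})\to\mathcal{G}_1$ be defined by $$\Gamma_1x=\tfrac{1}{\sqrt{2}}(F_1x+L_0^{-1}F_2x)\quad\text{and}\quad\Gamma_2x=\tfrac{1}{\sqrt{2}}(F_1x-L_0^{-1}F_2x),$$ where $F_ix$ denotes the $i$-th component of $F(x,H_0^{\star}x)\in\mathcal{G}_1\oplus\mathcal{G}_2$. Then $(\mathcal{G}_1,\Gamma_1,\Gamma_2)$ is a boundary triplet for $H_0$.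
   Context: Note $D(-H_0^\star)=D(H_0^\star)$. Boundary system for $H_0$: a quintuple $(\Omega,\mathcal{G}_1,\mathcal{G}_2,F,\omega)$ where $\Omega$ is a sesquilinear form on $\mathcal{H}\oplus\mathcal{H}$, $\mathcal{G}_1,\mathcal{G}_2$ are Hilbert spaces, $\omega$ is a sesquilinear form on $\mathcal{G}_1\oplus\mathcal{G}_2$, and $F\colon\operatorname{Graph}(H_0^{\star})\to\mathcal{G}_1\oplus\mathcal{G}_2$ is a surjective map such that $\Omega((x,H_0^{\star}x),(y,H_0^{\star}y))=\omega(F(x,H_0^{\star}x),F(y,H_0^{\star}y))$ for all $x,y\in D(H_0^{\star})$. Standard symmetric form on $\mathcal{H}\oplus\mathcal{H}$: $\Omega((x,y),(u,v))=(x,v)_{\mathcal{H}}+(y,u)_{\mathcal{H}}$. Standard unitary form on $\mathcal{G}_1\oplus\mathcal{G}_2$: $\omega((x,y),(u,v))=(x,u)_{\mathcal{G}_1}-(y,v)_{\mathcal{G}_2}$. Boundary triplet for $H_0$: a triple $(\mathcal{G},\Gamma_1,\Gamma_2)$ where $\mathcal{G}$ is a Hilbert space and $\Gamma_1,\Gamma_2\colon D(-H_0^{\star})\to\mathcal{G}$ are linear maps such that $D(-H_0^{\star})\to\mathcal{G}\oplus\mathcal{G}$, $x\mapsto(\Gamma_1x,\Gamma_2x)$ is surjective and $(H_0^{\star}x,y)_{\mathcal{H}}+(x,H_0^{\star}y)_{\mathcal{H}}=(\Gamma_1x,\Gamma_2y)_{\mathcal{G}}+(\Gamma_2x,\Gamma_1y)_{\mathcal{G}}$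 for all $x,y\in D(-H_0^{\star})$. *)

theory Defs
  imports "HOL-Analysis.Analysis"
begin

section \<open>Complex Hilbert spaces\<close>

class complex_vector = real_vector +
  fixes scaleC :: "complex \<Rightarrow> 'a \<Rightarrow> 'a" (infixr "*\<^sub>C" 75)
  assumes scaleC_add_right: "a *\<^sub>C (x + y) = a *\<^sub>C x + a *\<^sub>C y"
    and scaleC_add_left: "(a + b) *\<^sub>C x = a *\<^sub>C x + b *\<^sub>C x"
    and scaleC_scaleC: "a *\<^sub>C b *\<^sub>C x = (a * b) *\<^sub>C x"
    and scaleR_scaleC: "r *\<^sub>R x = complex_of_real r *\<^sub>C x"

text \<open>Inner products are linear in the first and conjugate linear in the second argument.
  The triangle inequality inherited from \<^class>\<open>real_normed_vector\<close> is redundant, since it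
  follows from the Cauchy--Schwarz inequality.\<close>

class complex_inner = complex_vector + real_normed_vector +
  fixes cinner :: "'a \<Rightarrow> 'a \<Rightarrow> complex"
  assumes cinner_commute: "cinner x y = cnj (cinner y x)"
    and cinner_add_left: "cinner (x + y) z = cinner x z + cinner y z"
    and cinner_scaleC_left: "cinner (a *\<^sub>C x) y = a * cinner x y"
    and cinner_ge_zero: "0 \<le> Re (cinner x x)"
    and cinner_eq_zero_iff: "cinner x x = 0 \<longleftrightarrow> x = 0"
    and norm_eq_sqrt_cinner: "norm x = sqrt (Re (cinner x x))"

class chilbert_space = complex_inner + complete_space

instantiation complex :: chilbert_space
begin

definition scaleC_complex :: "complex \<Rightarrow> complex \<Rightarrow> complex"
  where "scaleC_complex a x = a * x"

definition cinner_complex :: "complex \<Rightarrow> complex \<Rightarrow> complex"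
  where "cinner_complex x y = x * cnj y"

instance
proof
  fix a b x y z :: complex and r :: real
  show "a *\<^sub>C (x + y) = a *\<^sub>C x + a *\<^sub>C y" "(a + b) *\<^sub>C x = a *\<^sub>C x + b *\<^sub>C x"
    "a *\<^sub>C b *\<^sub>C x = (a * b) *\<^sub>C x" "r *\<^sub>R x = complex_of_real r *\<^sub>C x"
    by (simp_all add: scaleC_complex_def algebra_simps scaleR_conv_of_real)
  show "cinner x y = cnj (cinner y x)" "cinner (x + y) z = cinner x z + cinner y z"
    "cinner (a *\<^sub>C x) y = a * cinner x y" "0 \<le> Re (cinner x x)"
    "cinner x x = 0 \<longleftrightarrow> x = 0" "norm x = sqrt (Re (cinner x x))"
    by (simp_all add: cinner_complex_def scaleC_complex_def algebra_simps
        cmod_def power2_eq_square)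
qed

end

text \<open>The Hilbert direct sum of two Hilbert spaces is their product type; norm and topology of
  \<^theory>\<open>HOL-Analysis.Product_Vector\<close> are the ones of the direct sum.\<close>

instantiation prod :: (complex_vector, complex_vector) complex_vector
begin

definition scaleC_prod :: "complex \<Rightarrow> 'a \<times> 'b \<Rightarrow> 'a \<times> 'b"
  where "scaleC_prod a z = (a *\<^sub>C fst z, a *\<^sub>C snd z)"

instance
  by standard
    (simp_all add: scaleC_prod_def prod_eq_iff scaleC_add_right scaleC_add_left scaleC_scaleC
      scaleR_scaleC)

end

instantiation prod :: (complex_inner, complex_inner) complex_inner
begin

definition cinner_prod :: "'a \<times> 'b \<Rightarrow> 'a \<times> 'b \<Rightarrow> complex"
  where "cinner_prod z w = cinner (fst z) (fst w) + cinner (snd z) (snd w)"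

instance
proof
  fix a :: complex and x y z :: "'a \<times> 'b"
  show "cinner x y = cnj (cinner y x)"
    using cinner_commute[of "fst x" "fst y"] cinner_commute[of "snd x" "snd y"]
    by (simp add: cinner_prod_def)
  show "cinner (x + y) z = cinner x z + cinner y z"
    by (simp add: cinner_prod_def cinner_add_left)
  show "cinner (a *\<^sub>C x) y = a * cinner x y"
    by (simp add: cinner_prod_def scaleC_prod_def cinner_scaleC_left distrib_left)
  show "0 \<le> Re (cinner x x)"
    by (simp add: cinner_prod_def cinner_ge_zero)
  have n: "(norm v)\<^sup>2 = Re (cinner v v)" for v :: "'c::complex_inner"
    by (simp add: norm_eq_sqrt_cinner cinner_ge_zero)
  show "norm x = sqrt (Re (cinner x x))"
    by (simp add: cinner_prod_def norm_prod_def n)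
  have "x = 0" if "cinner x x = 0"
  proof -
    have "Re (cinner (fst x) (fst x)) + Re (cinner (snd x) (snd x)) = 0"
      using that by (simp add: cinner_prod_def complex_eq_iff)
    then have "(norm (fst x))\<^sup>2 + (norm (snd x))\<^sup>2 = 0"
      by (simp add: n)
    then show "x = 0"
      by (simp add: prod_eq_iff sum_power2_eq_zero_iff)
  qed
  moreover have "cinner (0::'a \<times> 'b) 0 = 0"
    using cinner_eq_zero_iff[of "0::'a"] cinner_eq_zero_iff[of "0::'b"]
    by (simp add: cinner_prod_def)
  ultimately show "cinner x x = 0 \<longleftrightarrow> x = 0"
    by blast
qed

end

instance prod :: (chilbert_space, chilbert_space) chilbert_space ..


section \<open>Linear operators and adjoints\<close>

text \<open>A possibly unbounded operator is given by its domain and by a function of which only the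
  values on the domain matter.\<close>

definition csubspace :: "'a::complex_vector set \<Rightarrow> bool"
  where "csubspace S \<longleftrightarrow>
    0 \<in> S \<and> (\<forall>x\<in>S. \<forall>y\<in>S. x + y \<in> S) \<and> (\<forall>a. \<forall>x\<in>S. a *\<^sub>C x \<in> S)"

definition linear_operator ::
    "'a::complex_vector set \<Rightarrow> ('a \<Rightarrow> 'b::complex_vector) \<Rightarrow> bool"
  where "linear_operator D A \<longleftrightarrow> csubspace D \<and>
    (\<forall>x\<in>D. \<forall>y\<in>D. A (x + y) = A x + A y) \<and> (\<forall>a. \<forall>x\<in>D. A (a *\<^sub>C x) = a *\<^sub>C A x)"

definition op_graph :: "'a set \<Rightarrow> ('a \<Rightarrow> 'b) \<Rightarrow> ('a \<times> 'b) set"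
  where "op_graph D A = (\<lambda>x. (x, A x)) ` D"

definition densely_defined :: "'a::topological_space set \<Rightarrow> bool"
  where "densely_defined D \<longleftrightarrow> closure D = UNIV"

definition closed_operator ::
    "'a::topological_space set \<Rightarrow> ('a \<Rightarrow> 'b::topological_space) \<Rightarrow> bool"
  where "closed_operator D A \<longleftrightarrow> closed (op_graph D A)"

definition adj_dom :: "'a::complex_inner set \<Rightarrow> ('a \<Rightarrow> 'b::complex_inner) \<Rightarrow> 'b set"
  where "adj_dom D A = {y. \<exists>z. \<forall>x\<in>D. cinner (A x) y = cinner x z}"

definition adj :: "'a::complex_inner set \<Rightarrow> ('a \<Rightarrow> 'b::complex_inner) \<Rightarrow> 'b \<Rightarrow> 'a"
  where "adj D A y = (THE z. \<forall>x\<in>D. cinner (A x) y = cinner x z)"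

definition unitary_operator :: "('a::chilbert_space \<Rightarrow> 'b::chilbert_space) \<Rightarrow> bool"
  where "unitary_operator U \<longleftrightarrow>
    linear_operator UNIV U \<and> surj U \<and> (\<forall>x y. cinner (U x) (U y) = cinner x y)"


section \<open>Boundary systems and boundary triplets\<close>

definition sesquilinear :: "('a::complex_vector \<Rightarrow> 'a \<Rightarrow> complex) \<Rightarrow> bool"
  where "sesquilinear B \<longleftrightarrow>
    (\<forall>x y z. B (x + y) z = B x z + B y z) \<and> (\<forall>a x y. B (a *\<^sub>C x) y = a * B x y) \<and>
    (\<forall>x y z. B x (y + z) = B x y + B x z) \<and> (\<forall>a x y. B x (a *\<^sub>C y) = cnj a * B x y)"

definition standard_symmetric_form :: "'h::complex_inner \<times> 'h \<Rightarrow> 'h \<times> 'h \<Rightarrow> complex"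
  where "standard_symmetric_form = (\<lambda>(x, y) (u, v). cinner x v + cinner y u)"

definition standard_unitary_form ::
    "'g1::complex_inner \<times> 'g2::complex_inner \<Rightarrow> 'g1 \<times> 'g2 \<Rightarrow> complex"
  where "standard_unitary_form = (\<lambda>(x, y) (u, v). cinner x u - cinner y v)"

text \<open>The Hilbert spaces of a boundary system and of a boundary triplet are the types of the
  arguments. The boundary map \<open>F\<close> matters only on the graph of the adjoint; it is not
  required to be linear.\<close>

definition boundary_system ::
    "'h::chilbert_space set \<Rightarrow> ('h \<Rightarrow> 'h) \<Rightarrow> ('h \<times> 'h \<Rightarrow> 'h \<times> 'h \<Rightarrow> complex) \<Rightarrow>
     ('h \<times> 'h \<Rightarrow> 'g1::chilbert_space \<times> 'g2::chilbert_space) \<Rightarrow>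
     ('g1 \<times> 'g2 \<Rightarrow> 'g1 \<times> 'g2 \<Rightarrow> complex) \<Rightarrow> bool"
  where "boundary_system D H \<Omega> F \<omega> \<longleftrightarrow>
    sesquilinear \<Omega> \<and> sesquilinear \<omega> \<and>
    F ` op_graph (adj_dom D H) (adj D H) = UNIV \<and>
    (\<forall>x\<in>adj_dom D H. \<forall>y\<in>adj_dom D H.
      \<Omega> (x, adj D H x) (y, adj D H y) = \<omega> (F (x, adj D H x)) (F (y, adj D H y)))"

text \<open>Since \<open>-A\<close> and \<open>A\<close> have the same domain, the domain of \<open>\<Gamma>\<^sub>1\<close> and \<open>\<Gamma>\<^sub>2\<close> is that of the
  adjoint.\<close>

definition boundary_triplet ::
    "'h::chilbert_space set \<Rightarrow> ('h \<Rightarrow> 'h) \<Rightarrow>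
     ('h \<Rightarrow> 'g::chilbert_space) \<Rightarrow> ('h \<Rightarrow> 'g) \<Rightarrow> bool"
  where "boundary_triplet D H \<Gamma>\<^sub>1 \<Gamma>\<^sub>2 \<longleftrightarrow>
    linear_operator (adj_dom D H) \<Gamma>\<^sub>1 \<and> linear_operator (adj_dom D H) \<Gamma>\<^sub>2 \<and>
    (\<lambda>x. (\<Gamma>\<^sub>1 x, \<Gamma>\<^sub>2 x)) ` adj_dom D H = UNIV \<and>
    (\<forall>x\<in>adj_dom D H. \<forall>y\<in>adj_dom D H.
      cinner (adj D H x) y + cinner x (adj D H y) =
      cinner (\<Gamma>\<^sub>1 x) (\<Gamma>\<^sub>2 y) + cinner (\<Gamma>\<^sub>2 x) (\<Gamma>\<^sub>1 y))"

end

theory Submission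
  imports Defs
begin

text \<open>The boundary map \<open>F\<close> is not assumed linear, but it is: the adjoint is linear, so by the
  abstract Green identity \<open>F (x + y) - F x - F y\<close> is \<open>\<omega>\<close>-orthogonal to the range of \<open>F\<close>, which is
  everything, and the standard unitary form is nondegenerate. Up to the unitary \<open>L\<^sub>0\<close>, the passage
  from \<open>(F\<^sub>1, F\<^sub>2)\<close> to \<open>(\<Gamma>\<^sub>1, \<Gamma>\<^sub>2)\<close> is the self-inverse map \<open>(a, b) \<mapsto> (a + b, a - b) / sqrt 2\<close>, which turns the
  form \<open>(a, c) - (b, d)\<close> into the form of a boundary triplet.\<close>

section \<open>Inner product rules and orthogonality to dense sets\<close>

lemma cinner_add_right: "cinner x (y + z) = cinner x y + cinner x z"
  for x y z :: "'a::complex_inner"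
  by (metis cinner_commute cinner_add_left complex_cnj_add)

lemma cinner_scaleC_right: "cinner x (a *\<^sub>C y) = cnj a * cinner x y"
  for x y :: "'a::complex_inner"
  by (metis cinner_commute cinner_scaleC_left complex_cnj_mult)

lemma scaleC_minus1: "(-1) *\<^sub>C x = - x"
  for x :: "'a::complex_vector"
  using scaleR_scaleC[of "-1" x] by simp

lemma cinner_minus_left: "cinner (- x) y = - cinner x y"
  for x y :: "'a::complex_inner"
  using cinner_scaleC_left[of "-1" x y] by (simp add: scaleC_minus1)

lemma cinner_minus_right: "cinner x (- y) = - cinner x y"
  for x y :: "'a::complex_inner"
  using cinner_scaleC_right[of x "-1" y] by (simp add: scaleC_minus1)

lemma cinner_diff_left: "cinner (x - y) z = cinner x z - cinner y z"
  for x y z :: "'a::complex_inner"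
  using cinner_add_left[of x "- y" z] by (simp add: cinner_minus_left)

lemma cinner_diff_right: "cinner x (y - z) = cinner x y - cinner x z"
  for x y z :: "'a::complex_inner"
  using cinner_add_right[of x y "- z"] by (simp add: cinner_minus_right)

lemma cinner_scaleR_left: "cinner (r *\<^sub>R x) y = r * cinner x y"
  for x y :: "'a::complex_inner"
  by (simp add: scaleR_scaleC cinner_scaleC_left)

lemma cinner_scaleR_right: "cinner x (r *\<^sub>R y) = r * cinner x y"
  for x y :: "'a::complex_inner"
  by (simp add: scaleR_scaleC cinner_scaleC_right)

lemma cinner_zero_right: "cinner x 0 = 0"
  for x :: "'a::complex_inner"
  using cinner_diff_right[of x 0 0] by simp

lemma norm_squared_eq_cinner: "(norm x)\<^sup>2 = Re (cinner x x)"
  for x :: "'a::complex_inner"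
  by (simp add: norm_eq_sqrt_cinner cinner_ge_zero)

text \<open>Reduces continuity of the real part of the inner product to continuity of the
  norm.\<close>

lemma Re_cinner_polarization:
  "Re (cinner x y) = ((norm (x + y))\<^sup>2 - (norm (x - y))\<^sup>2) / 4"
  for x y :: "'a::complex_inner"
proof -
  have "Re (cinner y x) = Re (cinner x y)"
    by (subst cinner_commute) simp
  then show ?thesis
    by (simp add: norm_squared_eq_cinner cinner_add_left cinner_add_right
        cinner_diff_left cinner_diff_right)
qed

text \<open>The set where the real part of \<open>cinner x z\<close> vanishes is closed and contains
  \<open>D\<close>, so it contains \<open>z\<close> itself. The real part suffices because
  \<open>cinner z z\<close> has real part \<open>(norm z)\<^sup>2\<close>.\<close>

lemma orthogonal_to_dense_eq_0:
  fixes D :: "'a::complex_inner set"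
  assumes "densely_defined D" and orth: "\<And>x. x \<in> D \<Longrightarrow> cinner x z = 0"
  shows "z = 0"
proof -
  have "closed {x. Re (cinner x z) = 0}"
    unfolding Re_cinner_polarization by (intro closed_Collect_eq continuous_intros) simp
  moreover have "D \<subseteq> {x. Re (cinner x z) = 0}"
    using orth by auto
  ultimately have "closure D \<subseteq> {x. Re (cinner x z) = 0}"
    by (rule closure_minimal[rotated])
  then have "Re (cinner z z) = 0"
    using assms(1) by (auto simp: densely_defined_def)
  then show ?thesis
    using norm_squared_eq_cinner[of z] by simp
qed

section \<open>The adjoint of a densely defined operator\<close>

text \<open>Two representing vectors differ by a vector orthogonal to the dense set
  \<open>D\<close>, so any witness is the one described by \<open>THE\<close> in
  \<open>adj\<close>.\<close>

lemma adj_eqI: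
  assumes "densely_defined D" and "\<And>x. x \<in> D \<Longrightarrow> cinner (A x) y = cinner x z"
  shows "adj D A y = z"
  unfolding adj_def
proof (rule the_equality)
  show "w = z" if "\<forall>x\<in>D. cinner (A x) y = cinner x w" for w
  proof -
    have "w - z = 0"
      using assms that by (intro orthogonal_to_dense_eq_0[of D]) (auto simp: cinner_diff_right)
    then show ?thesis by simp
  qed
qed (use assms(2) in simp)

lemma cinner_adj:
  assumes "densely_defined D" and "y \<in> adj_dom D A" and "x \<in> D"
  shows "cinner (A x) y = cinner x (adj D A y)"
proof -
  obtain z where z: "\<And>x. x \<in> D \<Longrightarrow> cinner (A x) y = cinner x z"
    using assms(2) by (auto simp: adj_dom_def)
  with adj_eqI[OF assms(1), of A y z] show ?thesis
    using assms(3) by simp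
qed

text \<open>The identities \<open>add\<close> and \<open>scale\<close> are each used twice: their
  right-hand sides exhibit the witness for membership in \<open>adj_dom\<close>, and by uniqueness
  this witness is the value of the adjoint.\<close>

lemma linear_operator_adj:
  assumes "densely_defined D"
  shows "linear_operator (adj_dom D A) (adj D A)"
proof -
  have zero: "0 \<in> adj_dom D A"
    by (auto simp: adj_dom_def cinner_zero_right intro: exI[of _ 0])
  have add: "cinner (A w) (x + y) = cinner w (adj D A x + adj D A y)"
    if "x \<in> adj_dom D A" "y \<in> adj_dom D A" "w \<in> D" for x y w
    using that by (simp add: cinner_add_right cinner_adj[OF assms])
  have scale: "cinner (A w) (a *\<^sub>C x) = cinner w (a *\<^sub>C adj D A x)"
    if "x \<in> adj_dom D A" "w \<in> D" for a x w
    using that by (simp add: cinner_scaleC_right cinner_adj[OF assms])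
  have "csubspace (adj_dom D A)"
    unfolding csubspace_def
  proof (intro conjI ballI allI zero)
    show "x + y \<in> adj_dom D A" if "x \<in> adj_dom D A" "y \<in> adj_dom D A" for x y
      unfolding adj_dom_def using add[OF that] by blast
    show "a *\<^sub>C x \<in> adj_dom D A" if "x \<in> adj_dom D A" for a x
      unfolding adj_dom_def using scale[OF that] by blast
  qed
  moreover have "adj D A (x + y) = adj D A x + adj D A y"
    if "x \<in> adj_dom D A" "y \<in> adj_dom D A" for x y
    using add[OF that] by (rule adj_eqI[OF assms])
  moreover have "adj D A (a *\<^sub>C x) = a *\<^sub>C adj D A x" if "x \<in> adj_dom D A" for a x
    using scale[OF that] by (rule adj_eqI[OF assms])
  ultimately show ?thesis
    by (simp add: linear_operator_def)
qed

section \<open>Linearity forced by a form identity\<close>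

lemma linear_operator_graph_map:
  assumes "linear_operator E A"
  shows "linear_operator E (\<lambda>x. (x, A x))"
  using assms by (simp add: linear_operator_def scaleC_prod_def)

text \<open>Pairings of \<open>f\<close> are moved to \<open>\<Omega>\<close>, expanded there by
  linearity of \<open>T\<close>, and moved back. In the application \<open>T\<close> is the graph
  embedding of the adjoint and \<open>f\<close> is the boundary map composed with it.\<close>

lemma linear_operator_of_form_identity:
  assumes T: "linear_operator E T" and sesq: "sesquilinear \<Omega>" "sesquilinear \<omega>"
    and nondeg: "\<And>u. (\<And>v. \<omega> u v = 0) \<Longrightarrow> u = 0"
    and onto: "f ` E = UNIV"
    and eq: "\<And>x y. x \<in> E \<Longrightarrow> y \<in> E \<Longrightarrow> \<Omega> (T x) (T y) = \<omega> (f x) (f y)"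
  shows "linear_operator E f"
proof -
  have E: "csubspace E"
    using T by (simp add: linear_operator_def)
  have diff: "\<omega> (u - v) w = \<omega> u w - \<omega> v w" for u v w
    using sesq(2) unfolding sesquilinear_def by (metis add_diff_cancel diff_add_cancel)
  have separates: "u = v" if "\<And>y. y \<in> E \<Longrightarrow> \<omega> u (f y) = \<omega> v (f y)" for u v
  proof -
    have "u - v = 0"
    proof (rule nondeg)
      fix w
      obtain y where "y \<in> E" "w = f y"
        using onto by (metis UNIV_I imageE)
      then show "\<omega> (u - v) w = 0"
        using that by (simp add: diff)
    qed
    then show ?thesis by simp
  qed
  have "f (x + y) = f x + f y" if "x \<in> E" "y \<in> E" for x y
  proof (rule separates)
    fix w assume w: "w \<in> E"
    have "x + y \<in> E"
      using E that by (simp add: csubspace_def)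
    then have "\<omega> (f (x + y)) (f w) = \<Omega> (T (x + y)) (T w)"
      using w by (simp add: eq)
    also have "\<dots> = \<Omega> (T x) (T w) + \<Omega> (T y) (T w)"
      using T sesq(1) that by (simp add: linear_operator_def sesquilinear_def)
    also have "\<dots> = \<omega> (f x + f y) (f w)"
      using sesq(2) that w by (simp add: sesquilinear_def eq)
    finally show "\<omega> (f (x + y)) (f w) = \<omega> (f x + f y) (f w)" .
  qed
  moreover have "f (a *\<^sub>C x) = a *\<^sub>C f x" if "x \<in> E" for a x
  proof (rule separates)
    fix w assume w: "w \<in> E"
    have "a *\<^sub>C x \<in> E"
      using E that by (simp add: csubspace_def)
    then have "\<omega> (f (a *\<^sub>C x)) (f w) = \<Omega> (T (a *\<^sub>C x)) (T w)"
      using w by (simp add: eq)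
    also have "\<dots> = a * \<Omega> (T x) (T w)"
      using T sesq(1) that by (simp add: linear_operator_def sesquilinear_def)
    also have "\<dots> = \<omega> (a *\<^sub>C f x) (f w)"
      using sesq(2) that w by (simp add: sesquilinear_def eq)
    finally show "\<omega> (f (a *\<^sub>C x)) (f w) = \<omega> (a *\<^sub>C f x) (f w)" .
  qed
  ultimately show ?thesis
    using E by (simp add: linear_operator_def)
qed

lemma standard_unitary_form_nondegenerate:
  assumes "\<And>v. standard_unitary_form u v = 0"
  shows "u = 0"
proof -
  \<comment> \<open>Flipping the sign of the second component turns the indefinite form into the
    inner product of the direct sum.\<close>
  have "standard_unitary_form u (fst u, - snd u) = 0"
    by (rule assms)
  then have "cinner u u = 0"
    by (simp add: standard_unitary_form_def case_prod_unfold cinner_prod_def cinner_minus_right)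
  then show ?thesis
    by (simp add: cinner_eq_zero_iff)
qed

section \<open>Inverses of unitary operators\<close>

lemma unitary_operator_inv:
  assumes "unitary_operator U"
  shows "bij U" and "unitary_operator (inv U)"
proof -
  have add: "U (x + y) = U x + U y" and scale: "U (a *\<^sub>C x) = a *\<^sub>C U x"
    and iso: "cinner (U x) (U y) = cinner x y" and "surj U" for a x y
    using assms by (auto simp: unitary_operator_def linear_operator_def)
  have "inj U"
  proof (rule injI)
    fix x y assume "U x = U y"
    \<comment> \<open>Both sides equal the pairing of the common image with \<open>U z\<close>;
      afterwards \<open>z\<close> is taken to be \<open>x - y\<close>.\<close>
    then have "cinner x z = cinner y z" for z
      using iso by metis
    then have "cinner (x - y) (x - y) = 0"
      by (simp add: cinner_diff_left)
    then show "x = y"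
      by (simp add: cinner_eq_zero_iff)
  qed
  with \<open>surj U\<close> show "bij U"
    by (simp add: bij_def)
  have inv_eqI: "inv U v = x" if "U x = v" for x v
    using \<open>inj U\<close> that by (rule inv_f_eq)
  have U_inv: "U (inv U v) = v" for v
    using \<open>surj U\<close> by (rule surj_f_inv_f)
  \<comment> \<open>By \<open>inv_eqI\<close> it is enough that \<open>U\<close> maps each
    right-hand side to the argument of \<open>inv U\<close> on the left.\<close>
  have "inv U (u + v) = inv U u + inv U v" "inv U (a *\<^sub>C u) = a *\<^sub>C inv U u" for a u v
    by (simp_all add: inv_eqI add scale U_inv)
  moreover have "cinner (inv U u) (inv U v) = cinner u v" for u v
    using iso[of "inv U u" "inv U v"] by (simp add: U_inv)
  moreover have "surj (inv U)"
    using \<open>inj U\<close> by (rule inj_imp_surj_inv)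
  ultimately show "unitary_operator (inv U)"
    by (simp add: unitary_operator_def linear_operator_def csubspace_def)
qed

section \<open>From the boundary system to the boundary triplet\<close>

theorem proposition2:
  fixes D :: "'h::chilbert_space set" and H\<^sub>0 :: "'h \<Rightarrow> 'h"
    and F :: "'h \<times> 'h \<Rightarrow> 'g1::chilbert_space \<times> 'g2::chilbert_space"
    and L\<^sub>0 :: "'g1 \<Rightarrow> 'g2"
    and \<Gamma>\<^sub>1 \<Gamma>\<^sub>2 :: "'h \<Rightarrow> 'g1"
  assumes "linear_operator D H\<^sub>0" and "densely_defined D" and "closed_operator D H\<^sub>0"
    and "boundary_system D H\<^sub>0 standard_symmetric_form F standard_unitary_form"
    and "unitary_operator L\<^sub>0"
    and "\<And>x. x \<in> adj_dom D H\<^sub>0 \<Longrightarrow>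
      \<Gamma>\<^sub>1 x = (1 / sqrt 2) *\<^sub>R (fst (F (x, adj D H\<^sub>0 x)) + inv L\<^sub>0 (snd (F (x, adj D H\<^sub>0 x))))"
    and "\<And>x. x \<in> adj_dom D H\<^sub>0 \<Longrightarrow>
      \<Gamma>\<^sub>2 x = (1 / sqrt 2) *\<^sub>R (fst (F (x, adj D H\<^sub>0 x)) - inv L\<^sub>0 (snd (F (x, adj D H\<^sub>0 x))))"
  shows "boundary_triplet D H\<^sub>0 \<Gamma>\<^sub>1 \<Gamma>\<^sub>2"
proof -
  define E where "E = adj_dom D H\<^sub>0"
  define f where "f x = F (x, adj D H\<^sub>0 x)" for x
  define V where "V = inv L\<^sub>0"
  define s :: real where "s = 1 / sqrt 2"
  have \<Gamma>1: "\<Gamma>\<^sub>1 x = s *\<^sub>R (fst (f x) + V (snd (f x)))"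
    and \<Gamma>2: "\<Gamma>\<^sub>2 x = s *\<^sub>R (fst (f x) - V (snd (f x)))" if "x \<in> E" for x
    using assms(6,7) that by (simp_all add: E_def f_def V_def s_def)
  have ss: "s * s = 1 / 2"
    by (simp add: s_def)
  then have ss_complex: "complex_of_real s * complex_of_real s = 1 / 2"
    by (metis of_real_mult of_real_divide of_real_1 of_real_numeral)
  have green: "standard_symmetric_form (x, adj D H\<^sub>0 x) (y, adj D H\<^sub>0 y)
      = standard_unitary_form (f x) (f y)" if "x \<in> E" "y \<in> E" for x y
    using assms(4) that by (simp add: boundary_system_def E_def f_def)
  have onto: "f ` E = UNIV"
    using assms(4) by (simp add: boundary_system_def E_def f_def op_graph_def image_image)
  have sesq: "sesquilinear (standard_symmetric_form :: 'h \<times> 'h \<Rightarrow> _)"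
      "sesquilinear (standard_unitary_form :: 'g1 \<times> 'g2 \<Rightarrow> _)"
    using assms(4) by (simp_all add: boundary_system_def)
  have f: "linear_operator E f"
    using linear_operator_graph_map[OF linear_operator_adj[OF assms(2), of H\<^sub>0]]
    unfolding E_def[symmetric]
    by (rule linear_operator_of_form_identity[OF _ sesq standard_unitary_form_nondegenerate onto
          green])
  have V: "unitary_operator V"
    using unitary_operator_inv(2)[OF assms(5)] by (simp add: V_def)
  then have V_add: "V (u + v) = V u + V v" and V_scale: "V (a *\<^sub>C u) = a *\<^sub>C V u"
    and V_iso: "cinner (V u) (V v) = cinner u v" for a u v
    by (simp_all add: unitary_operator_def linear_operator_def)
  \<comment> \<open>The normalising factor \<open>s\<close> is a real scalar, whereas homogeneity
    concerns complex ones.\<close>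
  have scaleR_scaleC_commute: "r *\<^sub>R a *\<^sub>C x = a *\<^sub>C r *\<^sub>R x" for r a and x :: 'g1
    by (simp add: scaleR_scaleC scaleC_scaleC mult.commute)
  have scaleC_diff_right: "a *\<^sub>C (x - y) = a *\<^sub>C x - a *\<^sub>C y" for a and x y :: 'g1
    by (metis add_diff_cancel diff_add_cancel scaleC_add_right)
  have "linear_operator E \<Gamma>\<^sub>1" "linear_operator E \<Gamma>\<^sub>2"
    using f unfolding linear_operator_def csubspace_def
    by (simp_all add: \<Gamma>1 \<Gamma>2 scaleC_prod_def V_add V_scale algebra_simps scaleC_add_right
        scaleC_diff_right scaleR_scaleC_commute)
  moreover have "(\<lambda>x. (\<Gamma>\<^sub>1 x, \<Gamma>\<^sub>2 x)) ` E = UNIV"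
  proof -
    have "(a, b) \<in> (\<lambda>x. (\<Gamma>\<^sub>1 x, \<Gamma>\<^sub>2 x)) ` E" for a b
    proof -
      \<comment> \<open>The prescribed value of \<open>f\<close> is the self-inverse transform of
        \<open>(a, b)\<close>, with its second component carried to the second space by
        \<open>L\<^sub>0\<close>, which \<open>V\<close> undoes.\<close>
      obtain x where x: "x \<in> E" "f x = (s *\<^sub>R (a + b), L\<^sub>0 (s *\<^sub>R (a - b)))"
        using onto by (metis UNIV_I imageE)
      have "V (L\<^sub>0 u) = u" for u
        using unitary_operator_inv(1)[OF assms(5)] by (simp add: V_def bij_def)
      moreover have "s * (s * 2) = 1"
        using ss by simp
      ultimately have "\<Gamma>\<^sub>1 x = a" "\<Gamma>\<^sub>2 x = b"
        using x
        by (simp_all add: \<Gamma>1 \<Gamma>2 scaleR_add_right[symmetric] scaleR_diff_right[symmetric]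
            scaleR_2[symmetric])
      with x(1) show ?thesis by force
    qed
    then show ?thesis by auto
  qed
  moreover have "cinner (adj D H\<^sub>0 x) y + cinner x (adj D H\<^sub>0 y) =
      cinner (\<Gamma>\<^sub>1 x) (\<Gamma>\<^sub>2 y) + cinner (\<Gamma>\<^sub>2 x) (\<Gamma>\<^sub>1 y)" if "x \<in> E" "y \<in> E" for x y
  proof -
    define a b c d where "a = fst (f x)" "b = V (snd (f x))" "c = fst (f y)" "d = V (snd (f y))"
    note defs = this
    have "cinner (\<Gamma>\<^sub>1 x) (\<Gamma>\<^sub>2 y) + cinner (\<Gamma>\<^sub>2 x) (\<Gamma>\<^sub>1 y)
        = complex_of_real s * complex_of_real s
          * (cinner (a + b) (c - d) + cinner (a - b) (c + d))"
      using that by (simp add: \<Gamma>1 \<Gamma>2 defs cinner_scaleR_left cinner_scaleR_right distrib_left mult.assoc)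
    \<comment> \<open>The mixed terms in \<open>a, d\<close> and in \<open>b, c\<close> cancel; the
      other two occur twice, which absorbs the factor \<open>1 / 2\<close>.\<close>
    also have "\<dots> = cinner a c - cinner b d"
      unfolding ss_complex
      by (simp add: cinner_add_left cinner_add_right cinner_diff_left cinner_diff_right)
    \<comment> \<open>Since \<open>V\<close> is isometric, pairing \<open>b\<close> with
      \<open>d\<close> equals pairing the second components of \<open>f x\<close> and
      \<open>f y\<close>.\<close>
    also have "\<dots> = standard_unitary_form (f x) (f y)"
      by (simp add: standard_unitary_form_def case_prod_unfold defs V_iso)
    also have "\<dots> = cinner (adj D H\<^sub>0 x) y + cinner x (adj D H\<^sub>0 y)"
      using green[OF that] by (simp add: standard_symmetric_form_def add.commute)
    finally show ?thesis ..
  qed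
  ultimately show ?thesis
    by (simp add: boundary_triplet_def E_def)
qed

end
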